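(* Let $G(n,m)=(V_\alpha\cup V_\beta,E)$ be a bipartite graph with $m\ge n$, and let $p$ be a positive integer. Then the solution to the optimization problem $$\max\ \operatorname{s-rsl} G^*(n,m),\quad G^*(n,m)=(V_\alpha\cup V_\beta,E^* ),\quad\text{s.t. } G^*(n,m)\succeq G(n,m)\ \text{ and }\ |E^*|-|E|=p,$$ is given by $$\max\{k\mid\delta^*(k)\le p\}.$$
   Context: $G(n,m)=(V_\alpha\cup V_\beta,E)$ is an undirected bipartite graph with $n$ left-nodes $V_\alpha=\{\alpha_1,\dots,\alpha_n\}$ and $m$ right-nodes $V_\beta=\{\beta_1,\dots,\beta_m\}$. $K=(V_\alpha\cup V_\beta,E_K)$ is the complete bipartite graph on these nodes. $G^*\succeq G$ means $E^*\supseteq E$. Definition of $\delta^*$: let $k$ be an integer with $0\le k\le m-1$ (the target degree of strong resilience). A $b$-matching is a subset $P\subseteq E_K$ such that each node $v\in V_\alpha\cup V_\beta$ is incident to at most $k+1$ edges of $P$. A fair $b$-matching is a $b$-matching of maximal cardinality such that, among those, $|P\cap E|$ is maximized. Set $\delta^*(k):=|P^*|-|P^*\cap E|$, where $P^*$ is a fair $b$-matching for this $k$; for given $G$, the value depends only on $k$ and not on the choice of $P^*$. Definition of $\operatorname{s-rsl}$ (degree of strong resilience): a sparsity pattern $\mathcal S(n,m)$ in $\mathbb R^{n\times m}$ is a vector subspace admitting a basis consisting only of matrices $E_{ij}$ ($1$ in entry $(i,j)$ and $0$ elsewhere); $E(\mathcal S)$ is the set of the corresponding pairs $(i,j)$;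 the rank of $\mathcal S$ is the maximal rank of matrices in $\mathcal S$. Patterns correspond one-to-one to bipartite graphs: $(\alpha_i,\beta_j)$ is an edge if and only if $(i,j)\in E(\mathcal S)$. A pattern $\mathcal S$ of rank $n$ is $0$-resilient if there exists a pattern $\mathcal S'$ with $E(\mathcal S')\subsetneq E(\mathcal S)$ and $|E(\mathcal S')|=|E(\mathcal S)|-1$ whose rank is less than $n$. A pattern $\mathcal S$ of rank $n$ is (exactly) strongly $k$-resilient, $k\ge 0$, if it contains a direct sum of $k+1$, but not $k+2$, sparsity patterns each of which is $0$-resilient; then $\operatorname{s-rsl}\mathcal S:=k$. By convention $\operatorname{s-rsl}\mathcal S:=-1$ if the rank of $\mathcal S$ is less than $n$. For a bipartite graph, $\operatorname{s-rsl}$ is that of its corresponding pattern. *)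

theory Defs
  imports "HOL-Analysis.Analysis"
begin

section \<open>Bipartite graphs and fair b-matchings\<close>

text \<open>The finite types 'n and 'm (both nonempty) are the sets of left and right nodes. A bipartite
  graph on them is its edge set, of type ('n * 'm) set; the edge set of the complete bipartite
  graph is UNIV.\<close>

definition left_degree :: "('n::finite \<times> 'm::finite) set \<Rightarrow> 'n \<Rightarrow> nat" where
  "left_degree P i = card {e \<in> P. fst e = i}"

definition right_degree :: "('n::finite \<times> 'm::finite) set \<Rightarrow> 'm \<Rightarrow> nat" where
  "right_degree P j = card {e \<in> P. snd e = j}"

definition b_matching :: "nat \<Rightarrow> ('n::finite \<times> 'm::finite) set \<Rightarrow> bool" where
  "b_matching k P \<longleftrightarrow> (\<forall>i. left_degree P i \<le> k + 1) \<and> (\<forall>j. right_degree P j \<le> k + 1)"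

definition maximum_b_matching :: "nat \<Rightarrow> ('n::finite \<times> 'm::finite) set \<Rightarrow> bool" where
  "maximum_b_matching k P \<longleftrightarrow>
     b_matching k P \<and> (\<forall>Q::('n \<times> 'm) set. b_matching k Q \<longrightarrow> card Q \<le> card P)"

definition fair_b_matching ::
  "('n::finite \<times> 'm::finite) set \<Rightarrow> nat \<Rightarrow> ('n \<times> 'm) set \<Rightarrow> bool" where
  "fair_b_matching E k P \<longleftrightarrow>
     maximum_b_matching k P \<and>
     (\<forall>Q. maximum_b_matching k Q \<longrightarrow> card (Q \<inter> E) \<le> card (P \<inter> E))"

definition delta_star :: "('n::finite \<times> 'm::finite) set \<Rightarrow> nat \<Rightarrow> nat" where
  "delta_star E k = (THE d. \<exists>P. fair_b_matching E k P \<and> d = card P - card (P \<inter> E))"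

lemma fair_b_matching_exists:
  fixes E :: "('n::finite \<times> 'm::finite) set"
  shows "\<exists>P. fair_b_matching E k P"
proof -
  have ne: "b_matching k ({} :: ('n \<times> 'm) set)"
    by (simp add: b_matching_def left_degree_def right_degree_def)
  have bound: "card Q < Suc CARD('n \<times> 'm)" for Q :: "('n \<times> 'm) set"
    by (intro le_imp_less_Suc card_mono) auto
  obtain P where "maximum_b_matching k (P :: ('n \<times> 'm) set)"
    using Lattices_Big.ex_has_greatest_nat[of "b_matching k", OF ne, of card "Suc CARD('n \<times> 'm)"] bound
    unfolding maximum_b_matching_def by blast
  then show ?thesis
    using Lattices_Big.ex_has_greatest_nat[of "maximum_b_matching k" P "\<lambda>Q. card (Q \<inter> E)" "Suc CARD('n \<times> 'm)"]
      bound
    unfolding fair_b_matching_def by blast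
qed

lemma delta_star_eq:
  assumes "fair_b_matching E k P"
  shows "delta_star E k = card P - card (P \<inter> E)"
  unfolding delta_star_def
proof (rule the_equality)
  fix d assume "\<exists>Q. fair_b_matching E k Q \<and> d = card Q - card (Q \<inter> E)"
  then obtain Q where Q: "fair_b_matching E k Q" "d = card Q - card (Q \<inter> E)" by blast
  have "card Q = card P" "card (Q \<inter> E) = card (P \<inter> E)"
    using assms Q(1) unfolding fair_b_matching_def maximum_b_matching_def
    by (auto intro: order_antisym)
  then show "d = card P - card (P \<inter> E)" using Q(2) by simp
qed (use assms in blast)

section \<open>Sparsity patterns\<close>

text \<open>The type real ^ 'm ^ 'n is the space of n x m matrices, rows being indexed by 'n.\<close>

definition matrix_unit :: "'n::finite \<Rightarrow> 'm::finite \<Rightarrow> real ^ 'm ^ 'n" where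
  "matrix_unit i j = axis i (axis j 1)"

definition unit_basis :: "(real ^ 'm::finite ^ 'n::finite) set \<Rightarrow> (real ^ 'm ^ 'n) set \<Rightarrow> bool" where
  "unit_basis B S \<longleftrightarrow> B \<subseteq> {matrix_unit i j | i j. True} \<and> independent B \<and> span B = S"

definition sparsity_pattern :: "(real ^ 'm::finite ^ 'n::finite) set \<Rightarrow> bool" where
  "sparsity_pattern S \<longleftrightarrow> (\<exists>B. unit_basis B S)"

definition pattern_edges :: "(real ^ 'm::finite ^ 'n::finite) set \<Rightarrow> ('n \<times> 'm) set" where
  "pattern_edges S = {(i, j). \<exists>B. unit_basis B S \<and> matrix_unit i j \<in> B}"

definition pattern_of :: "('n::finite \<times> 'm::finite) set \<Rightarrow> (real ^ 'm ^ 'n) set" where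
  "pattern_of E = span {matrix_unit i j | i j. (i, j) \<in> E}"

definition pattern_rank :: "(real ^ 'm::finite ^ 'n::finite) set \<Rightarrow> nat" where
  "pattern_rank S = Max (rank ` S)"

lemma matrix_unit_in_Basis: "matrix_unit i j \<in> Basis"
  by (simp add: matrix_unit_def)

lemma matrix_unit_eq_iff: "matrix_unit i j = matrix_unit i' j' \<longleftrightarrow> i = i' \<and> j = j'"
  by (auto simp: matrix_unit_def axis_eq_axis)

lemma unit_basis_pattern_of: "unit_basis {matrix_unit i j | i j. (i, j) \<in> E} (pattern_of E)"
  using matrix_unit_in_Basis
  by (auto simp: unit_basis_def pattern_of_def intro!: independent_substdbasis)

lemma unit_basis_subset:
  assumes "unit_basis B S" "unit_basis C S"
  shows "B \<subseteq> C"
proof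
  fix b assume b: "b \<in> B"
  have "B \<union> C \<subseteq> Basis"
    using assms matrix_unit_in_Basis unfolding unit_basis_def by blast
  then have "independent (insert b C)"
    using b by (intro independent_substdbasis) auto
  moreover have "b \<in> span C"
    using assms b span_base by (auto simp: unit_basis_def)
  ultimately show "b \<in> C"
    using dependent_def[of "insert b C"] by (metis Diff_insert_absorb insertI1)
qed

text \<open>Patterns and bipartite graphs correspond one-to-one.\<close>

lemma sparsity_pattern_pattern_of: "sparsity_pattern (pattern_of E)"
  using unit_basis_pattern_of sparsity_pattern_def by blast

lemma pattern_edges_pattern_of: "pattern_edges (pattern_of E) = E"
proof -
  have "B = {matrix_unit i j | i j. (i, j) \<in> E}" if "unit_basis B (pattern_of E)" for B
    using that unit_basis_pattern_of unit_basis_subset by blast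
  then show ?thesis
    using unit_basis_pattern_of[of E]
    by (fastforce simp: pattern_edges_def matrix_unit_eq_iff)
qed

lemma pattern_of_pattern_edges:
  assumes "sparsity_pattern S"
  shows "pattern_of (pattern_edges S) = S"
proof -
  obtain B where B: "unit_basis B S"
    using assms sparsity_pattern_def by blast
  have "C = B" if "unit_basis C S" for C
    using that B unit_basis_subset by blast
  then have "(i, j) \<in> pattern_edges S \<longleftrightarrow> matrix_unit i j \<in> B" for i j
    using B unfolding pattern_edges_def by blast
  then have "{matrix_unit i j | i j. (i, j) \<in> pattern_edges S} = B"
    using B unfolding unit_basis_def by fast
  then show ?thesis
    using B by (simp add: pattern_of_def unit_basis_def)
qed

section \<open>Degree of strong resilience\<close>

definition zero_resilient :: "(real ^ 'm::finite ^ 'n::finite) set \<Rightarrow> bool" where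
  "zero_resilient S \<longleftrightarrow>
     sparsity_pattern S \<and> pattern_rank S = CARD('n) \<and>
     (\<exists>S'. sparsity_pattern S' \<and> pattern_edges S' \<subset> pattern_edges S \<and>
           card (pattern_edges S') = card (pattern_edges S) - 1 \<and>
           pattern_rank S' < CARD('n))"

text \<open>S contains the (internal) direct sum of N zero-resilient patterns: the sum is direct because
  the zero matrix decomposes only trivially.\<close>

definition contains_zero_resilient_sum ::
  "(real ^ 'm::finite ^ 'n::finite) set \<Rightarrow> nat \<Rightarrow> bool" where
  "contains_zero_resilient_sum S N \<longleftrightarrow>
     (\<exists>T. (\<forall>i<N. zero_resilient (T i)) \<and>
          (\<forall>x. (\<forall>i<N. x i \<in> T i) \<and> (\<Sum>i<N. x i) = 0 \<longrightarrow> (\<forall>i<N. x i = 0)) \<and>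
          {\<Sum>i<N. x i | x. \<forall>i<N. x i \<in> T i} \<subseteq> S)"

definition strongly_resilient :: "nat \<Rightarrow> (real ^ 'm::finite ^ 'n::finite) set \<Rightarrow> bool" where
  "strongly_resilient k S \<longleftrightarrow>
     sparsity_pattern S \<and> pattern_rank S = CARD('n) \<and>
     contains_zero_resilient_sum S (k + 1) \<and> \<not> contains_zero_resilient_sum S (k + 2)"

definition s_rsl :: "(real ^ 'm::finite ^ 'n::finite) set \<Rightarrow> int" where
  "s_rsl S = (if pattern_rank S < CARD('n) then -1 else int (THE k. strongly_resilient k S))"

definition graph_s_rsl :: "('n::finite \<times> 'm::finite) set \<Rightarrow> int" where
  "graph_s_rsl E = s_rsl (pattern_of E)"

lemma contains_zero_resilient_sum_mono:
  fixes S :: "(real ^ 'm::finite ^ 'n::finite) set"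
  assumes "contains_zero_resilient_sum S N" "M \<le> N"
  shows "contains_zero_resilient_sum S M"
proof -
  obtain T where T: "\<And>i. i < N \<Longrightarrow> zero_resilient (T i)"
    and dir: "\<And>x. (\<forall>i<N. x i \<in> T i) \<Longrightarrow> (\<Sum>i<N. x i) = 0 \<Longrightarrow> \<forall>i<N. x i = 0"
    and sub: "{\<Sum>i<N. x i | x. \<forall>i<N. x i \<in> T i} \<subseteq> S"
    using assms(1) unfolding contains_zero_resilient_sum_def by blast
  have zero: "0 \<in> T i" if "i < N" for i
    using T[OF that] span_zero
    by (auto simp: zero_resilient_def sparsity_pattern_def unit_basis_def)
  define ext where "ext x i = (if i < M then x i else 0)" for x :: "nat \<Rightarrow> real ^ 'm ^ 'n" and i
  have ext_in: "\<forall>i<N. ext x i \<in> T i" if "\<forall>i<M. x i \<in> T i" for x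
    using that zero by (auto simp: ext_def)
  have ext_sum: "(\<Sum>i<N. ext x i) = (\<Sum>i<M. x i)" for x
    using assms(2) by (intro sum.mono_neutral_cong_right) (auto simp: ext_def)
  have "\<forall>i<M. x i = 0" if "\<forall>i<M. x i \<in> T i" "(\<Sum>i<M. x i) = 0" for x
    using dir[OF ext_in[OF that(1)]] that(2) assms(2) ext_sum[of x]
    by (metis ext_def order_less_le_trans)
  moreover have "{\<Sum>i<M. x i | x. \<forall>i<M. x i \<in> T i} \<subseteq> S"
    using sub ext_in ext_sum by (smt (verit) mem_Collect_eq subset_iff)
  ultimately show ?thesis
    unfolding contains_zero_resilient_sum_def using T assms(2)
    by (intro exI[of _ T]) auto
qed

lemma strongly_resilient_unique:
  assumes "strongly_resilient k S" "strongly_resilient l S"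
  shows "k = l"
proof (rule ccontr)
  assume "k \<noteq> l"
  then consider "k + 2 \<le> l + 1" | "l + 2 \<le> k + 1" by linarith
  then show False
    using assms contains_zero_resilient_sum_mono unfolding strongly_resilient_def by metis
qed

end

theory Submission
  imports Defs
begin

text \<open>The strong resilience of a pattern is one less than the largest number of edge-disjoint matchings
saturating all left nodes. A pattern has a matrix of full row rank if and only if its graph
contains such a matching (\<open>pattern_rank_full_iff\<close>): expanding the determinant of \<open>A ** B = mat 1\<close>
produces the matching from the matrix. So every zero-resilient pattern contains a left-perfect
matching, every left-perfect matching is zero-resilient, and directness of a sum means that
the matchings are edge-disjoint (\<open>matching_packing_imp_contains_sum\<close>,
\<open>contains_sum_imp_matching_packing\<close>).

A graph has \<open>k + 1\<close> edge-disjoint left-perfect matchings if and only if it has a subgraph with all left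
degrees equal to \<open>k + 1\<close> and all right degrees at most \<open>k + 1\<close> (\<open>matching_packing_iff_subgraph\<close>). The
nontrivial direction is Koenig's theorem that a bipartite graph of maximum degree at most \<open>d\<close> has a
proper edge colouring with \<open>d\<close> colours (\<open>koenig_edge_coloring\<close>). As there are at least as many right as
left nodes, for \<open>k < CARD('m)\<close> these subgraphs are exactly the maximum b-matchings of the
complete graph (\<open>maximum_b_matching_iff\<close>).

Consequently an augmentation has strong resilience at least \<open>k\<close> if and only if it contains a maximum
b-matching. The least number of new edges that this requires is \<open>delta_star E k\<close>, so \<open>p\<close> new edges
suffice if and only if \<open>delta_star E k \<le> p\<close> (\<open>augmentation_reaches_iff\<close>). The theorem is this equivalence
for all \<open>k\<close> at once: a maximum of integers that are at least \<open>-1\<close> is determined by the natural numbers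
below it.\<close>

section \<open>Full rank and left-perfect matchings\<close>

definition left_perfect_matching :: "('n \<times> 'm) set \<Rightarrow> ('n \<Rightarrow> 'm) \<Rightarrow> bool" where
  "left_perfect_matching E f \<longleftrightarrow> inj f \<and> (\<forall>i. (i, f i) \<in> E)"

lemma matrix_unit_nth: "matrix_unit i j $ i' $ j' = (if i = i' \<and> j = j' then 1 else 0)"
  by (auto simp: matrix_unit_def axis_def)

lemma mem_pattern_of_iff:
  fixes E :: "('n::finite \<times> 'm::finite) set"
  shows "x \<in> pattern_of E \<longleftrightarrow> (\<forall>i j. (i, j) \<notin> E \<longrightarrow> x $ i $ j = 0)"
proof -
  let ?B = "{matrix_unit i j | i j. (i, j) \<in> E}"
  have Basis: "Basis = {matrix_unit i j :: real ^ 'm ^ 'n | i j. True}"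
    by (auto simp: matrix_unit_def Basis_vec_def)
  have "x \<in> pattern_of E \<longleftrightarrow> (\<forall>b\<in>Basis. b \<notin> ?B \<longrightarrow> x \<bullet> b = 0)"
    unfolding pattern_of_def using span_substd_basis[of ?B] matrix_unit_in_Basis by blast
  moreover have "x \<bullet> matrix_unit i j = x $ i $ j" for i j
    by (simp add: matrix_unit_def inner_axis)
  moreover have "(\<forall>b\<in>Basis. b \<notin> ?B \<longrightarrow> x \<bullet> b = 0)
      \<longleftrightarrow> (\<forall>i j. matrix_unit i j \<notin> ?B \<longrightarrow> x \<bullet> matrix_unit i j = 0)"
    unfolding Basis by blast
  ultimately have "x \<in> pattern_of E \<longleftrightarrow> (\<forall>i j. matrix_unit i j \<notin> ?B \<longrightarrow> x $ i $ j = 0)"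
    by simp
  then show ?thesis
    by (simp add: matrix_unit_eq_iff)
qed

text \<open>The Leibniz formula with every entry of the product written as a sum: expanding the product over
the rows selects one middle index \<open>f i\<close> for each row \<open>i\<close>. Only injective \<open>f\<close> contribute, so this is the
Cauchy-Binet formula before its terms are grouped by the range of \<open>f\<close>.\<close>

lemma det_matrix_mult_expand:
  fixes A :: "'a::comm_ring_1 ^ 'm::finite ^ 'n::finite" and B :: "'a ^ 'n ^ 'm"
  shows "det (A ** B) = (\<Sum>f\<in>UNIV. (\<Prod>i\<in>UNIV. A $ i $ f i) * det (\<chi> i. B $ f i))"
proof -
  let ?P = "{p. p permutes (UNIV :: 'n set)}"
  have "det (A ** B) = (\<Sum>p\<in>?P. of_int (sign p) * (\<Prod>i\<in>UNIV. \<Sum>j\<in>UNIV. A $ i $ j * B $ j $ p i))"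
    by (simp add: det_def matrix_matrix_mult_def)
  also have "\<dots> = (\<Sum>p\<in>?P. of_int (sign p) * (\<Sum>f\<in>UNIV. \<Prod>i\<in>UNIV. A $ i $ f i * B $ f i $ p i))"
    by (subst prod_sum_PiE) (auto simp: PiE_UNIV_domain)
  also have "\<dots> = (\<Sum>p\<in>?P. \<Sum>f\<in>UNIV. (\<Prod>i\<in>UNIV. A $ i $ f i) * (of_int (sign p) * (\<Prod>i\<in>UNIV. B $ f i $ p i)))"
    by (simp add: sum_distrib_left prod.distrib mult_ac)
  also have "\<dots> = (\<Sum>f\<in>UNIV. (\<Prod>i\<in>UNIV. A $ i $ f i) * det (\<chi> i. B $ f i))"
    by (subst sum.swap) (simp add: det_def sum_distrib_left)
  finally show ?thesis .
qed

text \<open>A matrix of full row rank has a right inverse \<open>B\<close>, so the expansion of \<open>det (A ** B) = 1\<close> contains a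
nonzero term. In that term all chosen entries of \<open>A\<close> are nonzero, and the choice is injective because
otherwise the chosen minor of \<open>B\<close> would have two equal rows.\<close>

lemma full_rank_imp_nonzero_transversal:
  fixes A :: "real ^ 'm::finite ^ 'n::finite"
  assumes "rank A = CARD('n)"
  shows "\<exists>f. inj f \<and> (\<forall>i. A $ i $ f i \<noteq> 0)"
proof -
  obtain B where "A ** B = mat 1"
    using assms full_rank_surjective matrix_right_invertible_surjective by metis
  then have "det (A ** B) \<noteq> 0" by simp
  then obtain f where f: "(\<Prod>i\<in>UNIV. A $ i $ f i) * det (\<chi> i. B $ f i) \<noteq> 0"
    unfolding det_matrix_mult_expand by (metis (no_types, lifting) sum.neutral)
  have "inj f"
  proof (rule injI, rule ccontr)
    fix x y assume "f x = f y" "x \<noteq> y"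
    then have "det (\<chi> i. B $ f i) = 0"
      by (intro det_identical_rows[of x y]) (auto simp: row_def vec_eq_iff)
    with f show False by simp
  qed
  then show ?thesis using f by auto
qed

lemma
  fixes S :: "(real ^ 'm::finite ^ 'n::finite) set"
  assumes "S \<noteq> {}"
  shows pattern_rank_le_card: "pattern_rank S \<le> CARD('n)"
    and pattern_rank_attained: "\<exists>x\<in>S. rank x = pattern_rank S"
    and rank_le_pattern_rank: "x \<in> S \<Longrightarrow> rank x \<le> pattern_rank S"
proof -
  have bound: "rank ` S \<subseteq> {..CARD('n)}"
    using rank_bound by (force simp: image_subset_iff)
  then have fin: "finite (rank ` S)"
    using finite_subset by blast
  then have "pattern_rank S \<in> rank ` S"
    unfolding pattern_rank_def using assms by (intro Max_in) auto
  then show "pattern_rank S \<le> CARD('n)" "\<exists>x\<in>S. rank x = pattern_rank S"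
    using bound by auto
  show "x \<in> S \<Longrightarrow> rank x \<le> pattern_rank S"
    using fin by (simp add: pattern_rank_def)
qed

lemma zero_in_pattern_of: "0 \<in> pattern_of E"
  by (simp add: mem_pattern_of_iff)

lemma pattern_of_nonempty: "pattern_of E \<noteq> {}"
  using zero_in_pattern_of by blast

text \<open>The bridge from linear algebra to graphs: the nonzero entries of a matrix of full rank contain a
left-perfect matching, and conversely the 0-1 matrix of such a matching has its own transpose as a
right inverse.\<close>

lemma pattern_rank_full_iff:
  fixes E :: "('n::finite \<times> 'm::finite) set"
  shows "pattern_rank (pattern_of E) = CARD('n) \<longleftrightarrow> (\<exists>f. left_perfect_matching E f)"
proof
  assume "pattern_rank (pattern_of E) = CARD('n)"
  then obtain A where "A \<in> pattern_of E" "rank A = CARD('n)"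
    using pattern_rank_attained[OF pattern_of_nonempty, of E] by auto
  then show "\<exists>f. left_perfect_matching E f"
    using full_rank_imp_nonzero_transversal[of A] unfolding left_perfect_matching_def mem_pattern_of_iff by blast
next
  assume "\<exists>f. left_perfect_matching E f"
  then obtain f where inj: "inj f" and f: "\<And>i. (i, f i) \<in> E"
    unfolding left_perfect_matching_def by blast
  define A :: "real ^ 'm ^ 'n" where "A = (\<chi> i j. if j = f i then 1 else 0)"
  have "A ** transpose A = mat 1"
    using inj by (auto simp: vec_eq_iff A_def matrix_matrix_mult_def transpose_def mat_def inj_eq
        if_distrib[of "\<lambda>x. x * _"] cong: if_cong)
  then have "rank A = CARD('n)"
    using full_rank_surjective matrix_right_invertible_surjective by metis
  moreover have "A \<in> pattern_of E"
    using f by (auto simp: mem_pattern_of_iff A_def)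
  ultimately show "pattern_rank (pattern_of E) = CARD('n)"
    using pattern_rank_le_card[OF pattern_of_nonempty, of E] rank_le_pattern_rank[OF pattern_of_nonempty, of A E]
    by simp
qed

lemma pattern_rank_deficient_iff:
  fixes E :: "('n::finite \<times> 'm::finite) set"
  shows "pattern_rank (pattern_of E) < CARD('n) \<longleftrightarrow> (\<nexists>f. left_perfect_matching E f)"
  using pattern_rank_full_iff[of E] pattern_rank_le_card[OF pattern_of_nonempty, of E]
  by auto

section \<open>Zero-resilient patterns as matchings\<close>

definition graph_of :: "('n \<Rightarrow> 'm) \<Rightarrow> ('n \<times> 'm) set" where
  "graph_of f = {(i, f i) | i. True}"

text \<open>A left-perfect matching is a minimal pattern of full rank: without any one of its edges some left
node is isolated. Thus the patterns of matchings can serve as summands wherever zero-resilient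
patterns are asked for.\<close>

lemma zero_resilient_graph_of:
  fixes f :: "'n::finite \<Rightarrow> 'm::finite"
  assumes "inj f"
  shows "zero_resilient (pattern_of (graph_of f))"
proof -
  \<comment> \<open>Any left node will do; there is one since types are nonempty.\<close>
  fix i :: 'n
  let ?E' = "graph_of f - {(i, f i)}"
  have mem: "(i, f i) \<in> graph_of f"
    by (auto simp: graph_of_def)
  have "left_perfect_matching (graph_of f) f"
    using assms by (auto simp: left_perfect_matching_def graph_of_def)
  moreover have "\<nexists>g. left_perfect_matching ?E' g"
    by (auto simp: left_perfect_matching_def graph_of_def)
  moreover have "?E' \<subset> graph_of f" "card ?E' = card (graph_of f) - 1"
    using mem by auto
  ultimately show ?thesis
    unfolding zero_resilient_def
    using pattern_rank_full_iff pattern_rank_deficient_iff sparsity_pattern_pattern_of pattern_edges_pattern_of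
    by metis
qed

lemma zero_resilient_imp_matching:
  fixes T :: "(real ^ 'm::finite ^ 'n::finite) set"
  assumes "zero_resilient T"
  shows "\<exists>f. left_perfect_matching (pattern_edges T) f"
  using assms pattern_of_pattern_edges[of T] pattern_rank_full_iff[of "pattern_edges T"]
  by (simp add: zero_resilient_def)

section \<open>Strong resilience as packing of matchings\<close>

text \<open>Edge-disjointness of the matchings \<open>F 0, ..., F (N - 1)\<close> is stated at each left node \<open>i\<close>: the \<open>N\<close>
partners \<open>F t i\<close> are different.\<close>

definition matching_packing :: "('n \<times> 'm) set \<Rightarrow> nat \<Rightarrow> bool" where
  "matching_packing E N \<longleftrightarrow>
     (\<exists>F. (\<forall>t<N. left_perfect_matching E (F t)) \<and> (\<forall>i. inj_on (\<lambda>t. F t i) {..<N}))"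

text \<open>The matrices supported on edge-disjoint matchings have disjoint supports, so no entry of their sum
can cancel.\<close>

lemma matching_packing_imp_contains_sum:
  fixes E :: "('n::finite \<times> 'm::finite) set"
  assumes "matching_packing E N"
  shows "contains_zero_resilient_sum (pattern_of E) N"
proof -
  obtain F where F: "\<And>t. t < N \<Longrightarrow> left_perfect_matching E (F t)"
    and disj: "\<And>i. inj_on (\<lambda>t. F t i) {..<N}"
    using assms unfolding matching_packing_def by blast
  let ?T = "\<lambda>t. pattern_of (graph_of (F t))"
  have direct: "x t = 0" if x: "\<forall>t<N. x t \<in> ?T t" and sum0: "(\<Sum>t<N. x t) = 0" and t: "t < N" for x t
  proof -
    have zero: "x s $ i $ j = 0" if "s < N" "j \<noteq> F s i" for s i j
      using x that unfolding mem_pattern_of_iff graph_of_def by auto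
    have "x t $ i $ F t i = 0" for i
    proof -
      have "(\<Sum>s<N. x s $ i $ F t i) = (\<Sum>s\<in>{t}. x s $ i $ F t i)"
        using t disj[of i] zero by (intro sum.mono_neutral_right) (auto dest: inj_onD)
      then show ?thesis
        using arg_cong[OF sum0, of "\<lambda>y. y $ i $ F t i"] by simp
    qed
    then show ?thesis
      using zero[OF t] by (simp add: vec_eq_iff) metis
  qed
  have "(\<Sum>t<N. x t) \<in> pattern_of E" if "\<forall>t<N. x t \<in> ?T t" for x
  proof -
    have "x t $ i $ j = 0" if "t < N" "(i, j) \<notin> E" for t i j
      using \<open>\<forall>t<N. x t \<in> ?T t\<close> that F[OF that(1)]
      unfolding mem_pattern_of_iff graph_of_def left_perfect_matching_def by force
    then show ?thesis by (auto simp: mem_pattern_of_iff)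
  qed
  then show ?thesis
    unfolding contains_zero_resilient_sum_def
    using zero_resilient_graph_of F direct
    by (intro exI[of _ ?T]) (auto simp: left_perfect_matching_def)
qed

text \<open>Every summand has full rank and hence contains a left-perfect matching. Directness of the sum makes
these matchings edge-disjoint: an edge common to two summands would allow to write \<open>0\<close> as the sum of
its matrix unit and the negative of that unit.\<close>

lemma contains_sum_imp_matching_packing:
  fixes E :: "('n::finite \<times> 'm::finite) set"
  assumes "contains_zero_resilient_sum (pattern_of E) N"
  shows "matching_packing E N"
proof -
  obtain T where T: "\<And>t. t < N \<Longrightarrow> zero_resilient (T t)"
    and direct: "\<And>x. (\<forall>t<N. x t \<in> T t) \<Longrightarrow> (\<Sum>t<N. x t) = 0 \<Longrightarrow> \<forall>t<N. x t = 0"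
    and sub: "\<And>x. (\<forall>t<N. x t \<in> T t) \<Longrightarrow> (\<Sum>t<N. x t) \<in> pattern_of E"
    using assms unfolding contains_zero_resilient_sum_def by blast
  have Teq: "T t = pattern_of (pattern_edges (T t))" if "t < N" for t
    using T[OF that] pattern_of_pattern_edges zero_resilient_def by metis
  have zero: "0 \<in> T t" if "t < N" for t
    using Teq[OF that] zero_in_pattern_of by metis
  have unit: "matrix_unit i j \<in> T t" if "t < N" "(i, j) \<in> pattern_edges (T t)" for t i j
    using that by (subst Teq) (auto simp: mem_pattern_of_iff matrix_unit_nth)
  have nz: "matrix_unit i j \<noteq> (0 :: real ^ 'm ^ 'n)" for i :: 'n and j :: 'm
    by (simp add: matrix_unit_def axis_eq_0_iff)
  have edge: "(i, j) \<in> E" if "t < N" "(i, j) \<in> pattern_edges (T t)" for t i j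
  proof -
    let ?x = "\<lambda>s. if s = t then matrix_unit i j else (0 :: real ^ 'm ^ 'n)"
    have "(\<Sum>s<N. ?x s) \<in> pattern_of E"
      using zero unit[OF that] by (intro sub) auto
    then have "matrix_unit i j \<in> pattern_of E"
      using that(1) by simp
    then show ?thesis
      by (auto simp: mem_pattern_of_iff matrix_unit_nth split: if_splits)
  qed
  have disj: "s = t" if "s < N" "t < N" "(i, j) \<in> pattern_edges (T s)" "(i, j) \<in> pattern_edges (T t)" for s t i j
  proof (rule ccontr)
    assume st: "s \<noteq> t"
    let ?u = "matrix_unit i j :: real ^ 'm ^ 'n"
    \<comment> \<open>A sum of two conditionals rather than one nested conditional, so that the sum over \<open>r\<close> splits.\<close>
    let ?x = "\<lambda>r. (if r = s then ?u else 0) + (if r = t then - ?u else 0)"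
    have "- ?u \<in> T t"
      using unit[OF that(2,4)] by (subst (asm) Teq[OF that(2)], subst Teq[OF that(2)]) (simp add: mem_pattern_of_iff)
    then have "\<forall>r<N. ?x r \<in> T r"
      using zero unit[OF that(1,3)] st by auto
    moreover have "(\<Sum>r<N. ?x r) = 0"
      using that(1,2) by (simp add: sum.distrib)
    ultimately have "\<forall>r<N. ?x r = 0" by (rule direct)
    then have "?x s = 0" using that(1) by blast
    then show False using st nz by simp
  qed
  obtain F where F: "\<And>t. t < N \<Longrightarrow> left_perfect_matching (pattern_edges (T t)) (F t)"
    using zero_resilient_imp_matching[OF T] by metis
  show ?thesis
    unfolding matching_packing_def
  proof (intro exI[of _ F] conjI allI impI)
    fix t assume "t < N"
    then show "left_perfect_matching E (F t)"
      using F edge unfolding left_perfect_matching_def by blast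
  next
    fix i
    show "inj_on (\<lambda>t. F t i) {..<N}"
    proof (rule inj_onI)
      fix s t assume "s \<in> {..<N}" "t \<in> {..<N}" "F s i = F t i"
      then show "s = t"
        using F disj[of s t i "F t i"] unfolding left_perfect_matching_def by (metis lessThan_iff)
    qed
  qed
qed

lemma contains_sum_iff_matching_packing:
  fixes E :: "('n::finite \<times> 'm::finite) set"
  shows "contains_zero_resilient_sum (pattern_of E) N \<longleftrightarrow> matching_packing E N"
  using matching_packing_imp_contains_sum contains_sum_imp_matching_packing by blast

lemma matching_packing_bound:
  fixes E :: "('n::finite \<times> 'm::finite) set"
  assumes "matching_packing E N"
  shows "N \<le> CARD('m)"
proof -
  obtain F :: "nat \<Rightarrow> 'n \<Rightarrow> 'm" where F: "\<And>i. inj_on (\<lambda>t. F t i) {..<N}"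
    using assms unfolding matching_packing_def by blast
  show ?thesis
    using card_inj_on_le[OF F[of undefined], of UNIV] by simp
qed

lemma matching_packing_one_iff: "matching_packing E 1 \<longleftrightarrow> (\<exists>f. left_perfect_matching E f)"
proof
  assume "\<exists>f. left_perfect_matching E f"
  then obtain f where "left_perfect_matching E f" ..
  then show "matching_packing E 1"
    unfolding matching_packing_def by (intro exI[of _ "\<lambda>_. f"]) (auto intro: inj_onI)
qed (auto simp: matching_packing_def)

text \<open>The sizes of packings are bounded by the number of right nodes, so there is a largest one. This is
what makes the definite description in \<open>s_rsl\<close> meaningful for patterns of full rank.\<close>

lemma strongly_resilient_exists:
  fixes E :: "('n::finite \<times> 'm::finite) set"
  assumes "matching_packing E 1"
  shows "\<exists>k. strongly_resilient k (pattern_of E)"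
proof -
  let ?N = "Max {N. matching_packing E N}"
  have fin: "finite {N. matching_packing E N}"
    using matching_packing_bound finite_nat_set_iff_bounded_le by blast
  then have "matching_packing E ?N" "1 \<le> ?N"
    using assms Max_in[OF fin] by (auto intro: Max_ge)
  moreover have "\<not> matching_packing E (?N + 1)"
    using Max_ge[OF fin, of "?N + 1"] by auto
  moreover have "\<exists>f. left_perfect_matching E f"
    using assms unfolding matching_packing_one_iff .
  ultimately have "strongly_resilient (?N - 1) (pattern_of E)"
    by (simp add: strongly_resilient_def contains_sum_iff_matching_packing
        sparsity_pattern_pattern_of pattern_rank_full_iff)
  then show ?thesis ..
qed

lemma graph_s_rsl_eq:
  fixes E :: "('n::finite \<times> 'm::finite) set"
  assumes "strongly_resilient k (pattern_of E)"
  shows "graph_s_rsl E = int k"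
  using assms strongly_resilient_unique
  by (auto simp: graph_s_rsl_def s_rsl_def strongly_resilient_def intro!: the_equality)

text \<open>In this form the value \<open>-1\<close> for patterns of deficient rank needs no separate treatment: such a pattern
admits no packing, and no natural number is at most \<open>-1\<close>.\<close>

lemma graph_s_rsl_ge_iff:
  fixes E :: "('n::finite \<times> 'm::finite) set"
  shows "int k \<le> graph_s_rsl E \<longleftrightarrow> matching_packing E (k + 1)"
proof (cases "matching_packing E 1")
  case True
  then obtain l where l: "strongly_resilient l (pattern_of E)"
    using strongly_resilient_exists by blast
  then have "matching_packing E (k + 1) \<longleftrightarrow> k \<le> l"
    using contains_zero_resilient_sum_mono[of "pattern_of E"]
    unfolding strongly_resilient_def contains_sum_iff_matching_packing
    by (metis Suc_eq_plus1 add_2_eq_Suc' not_less_eq_eq Suc_le_mono)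
  then show ?thesis
    using graph_s_rsl_eq[OF l] by simp
next
  case False
  then have "graph_s_rsl E = -1"
    by (simp add: graph_s_rsl_def s_rsl_def pattern_rank_deficient_iff matching_packing_one_iff[simplified])
  moreover have "\<not> matching_packing E (k + 1)"
    using False contains_zero_resilient_sum_mono[of "pattern_of E" "k + 1" 1]
    unfolding contains_sum_iff_matching_packing by auto
  ultimately show ?thesis by simp
qed

lemma graph_s_rsl_ge_minus_one:
  fixes E :: "('n::finite \<times> 'm::finite) set"
  shows "-1 \<le> graph_s_rsl E"
  by (simp add: graph_s_rsl_def s_rsl_def)

section \<open>Edge colouring of bipartite graphs\<close>

definition proper_edge_coloring :: "('n \<times> 'm) set \<Rightarrow> nat \<Rightarrow> ('n \<times> 'm \<Rightarrow> nat) \<Rightarrow> bool" where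
  "proper_edge_coloring P d c \<longleftrightarrow>
     (\<forall>e\<in>P. c e < d) \<and>
     (\<forall>e\<in>P. \<forall>e'\<in>P. c e = c e' \<and> (fst e = fst e' \<or> snd e = snd e') \<longrightarrow> e = e')"

text \<open>The left and right nodes of the component of the right node \<open>v\<close> in the subgraph of the edges with
colours \<open>a\<close> and \<open>b\<close>, explored along paths whose colours alternate \<open>a, b, a, b, ...\<close>. Hence left nodes
are entered only by edges of colour \<open>a\<close> and right nodes other than \<open>v\<close> only by edges of colour \<open>b\<close>.\<close>

inductive kempe_left :: "('n \<times> 'm) set \<Rightarrow> ('n \<times> 'm \<Rightarrow> nat) \<Rightarrow> nat \<Rightarrow> nat \<Rightarrow> 'm \<Rightarrow> 'n \<Rightarrow> bool"
  and kempe_right :: "('n \<times> 'm) set \<Rightarrow> ('n \<times> 'm \<Rightarrow> nat) \<Rightarrow> nat \<Rightarrow> nat \<Rightarrow> 'm \<Rightarrow> 'm \<Rightarrow> bool"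
  for P c a b v where
  start: "kempe_right P c a b v v"
| to_left: "\<lbrakk>kempe_right P c a b v y; (x, y) \<in> P; c (x, y) = a\<rbrakk> \<Longrightarrow> kempe_left P c a b v x"
| to_right: "\<lbrakk>kempe_left P c a b v x; (x, y) \<in> P; c (x, y) = b\<rbrakk> \<Longrightarrow> kempe_right P c a b v y"

text \<open>The alternating paths do exhaust the component if \<open>v\<close> has no edge of colour \<open>b\<close>: in a proper colouring
the edge by which a node was entered is its only edge of that colour, so it leads back to a node
already reached.\<close>

lemma kempe_left_iff_right:
  assumes col: "proper_edge_coloring P d c" and miss: "\<And>x. (x, v) \<in> P \<Longrightarrow> c (x, v) \<noteq> b"
    and e: "(x, y) \<in> P" and ab: "c (x, y) = a \<or> c (x, y) = b"
  shows "kempe_left P c a b v x \<longleftrightarrow> kempe_right P c a b v y"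
proof
  assume L: "kempe_left P c a b v x"
  show "kempe_right P c a b v y"
  proof (cases "c (x, y) = b")
    case True
    then show ?thesis using L e kempe_left_kempe_right.to_right by fast
  next
    case False
    from L obtain y' where "kempe_right P c a b v y'" "(x, y') \<in> P" "c (x, y') = a"
      by cases
    moreover have "y' = y"
      using calculation(2,3) e ab False col unfolding proper_edge_coloring_def by fastforce
    ultimately show ?thesis by simp
  qed
next
  assume R: "kempe_right P c a b v y"
  show "kempe_left P c a b v x"
  proof (cases "c (x, y) = a")
    case True
    then show ?thesis using R e kempe_left_kempe_right.to_left by fast
  next
    case False
    from R show ?thesis
    proof cases
      case start
      then show ?thesis using miss e ab False by blast
    next
      case (to_right x')
      then have "x' = x"
        using e ab False col unfolding proper_edge_coloring_def by fastforce
      with to_right show ?thesis by simp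
    qed
  qed
qed

text \<open>The Kempe exchange. If \<open>a\<close> is missing at the left node \<open>u\<close> and \<open>b\<close> at the right node \<open>v\<close>, then \<open>u\<close> is not
in the component of \<open>v\<close>, since a left node would be entered by an edge of colour \<open>a\<close>; this is where
bipartiteness is used. Exchanging \<open>a\<close> and \<open>b\<close> on that component therefore makes \<open>a\<close> missing at \<open>v\<close> and
leaves it missing at \<open>u\<close>.\<close>

lemma kempe_swap:
  assumes col: "proper_edge_coloring P d c" and ab: "a < d" "b < d"
    and miss_u: "\<And>y. (u, y) \<in> P \<Longrightarrow> c (u, y) \<noteq> a"
    and miss_v: "\<And>x. (x, v) \<in> P \<Longrightarrow> c (x, v) \<noteq> b"
  obtains c' where "proper_edge_coloring P d c'"
    "\<And>y. (u, y) \<in> P \<Longrightarrow> c' (u, y) \<noteq> a" "\<And>x. (x, v) \<in> P \<Longrightarrow> c' (x, v) \<noteq> a"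
proof
  define sw where "sw t = (if t = a then b else if t = b then a else t)" for t
  let ?L = "kempe_left P c a b v" and ?R = "kempe_right P c a b v"
  define c' where "c' e = (if ?L (fst e) then sw (c e) else c e)" for e
  have sw_inj: "sw s = sw t \<longleftrightarrow> s = t" for s t
    by (auto simp: sw_def)
  have closed: "?L (fst e) \<longleftrightarrow> ?R (snd e)" if "e \<in> P" "c e = a \<or> c e = b" for e
    using kempe_left_iff_right[OF col miss_v, of "fst e" "snd e" a] that by simp
  have u: "\<not> ?L u"
    using miss_u by (auto elim: kempe_left.cases)
  have v: "?R v"
    by (rule kempe_left_kempe_right.start)
  show "proper_edge_coloring P d c'"
    unfolding proper_edge_coloring_def
  proof (intro conjI ballI impI)
    fix e assume "e \<in> P"
    then show "c' e < d"
      using col ab by (auto simp: c'_def sw_def proper_edge_coloring_def)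
  next
    fix e e' assume e: "e \<in> P" "e' \<in> P" and same: "c' e = c' e' \<and> (fst e = fst e' \<or> snd e = snd e')"
    \<comment> \<open>The two edges can lie on different sides of the component only if they meet in a right node,
      and then closedness rules out that both have colour \<open>a\<close> or \<open>b\<close>.\<close>
    have agree: "c e = c e'"
    proof (cases "?L (fst e) \<longleftrightarrow> ?L (fst e')")
      case True
      then show ?thesis using same sw_inj by (auto simp: c'_def split: if_splits)
    next
      case False
      then have snd: "snd e = snd e'" using same by auto
      have "\<not> ((c e = a \<or> c e = b) \<and> (c e' = a \<or> c e' = b))"
        using False closed[OF e(1)] closed[OF e(2)] snd by metis
      then show ?thesis
        using False same by (auto simp: c'_def sw_def split: if_splits)
    qed
    then show "e = e'"
      using col e same unfolding proper_edge_coloring_def by blast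
  qed
  show "\<And>y. (u, y) \<in> P \<Longrightarrow> c' (u, y) \<noteq> a"
    using u miss_u by (simp add: c'_def)
  show "c' (x, v) \<noteq> a" if "(x, v) \<in> P" for x
    using closed[OF that] v miss_v[OF that] by (auto simp: c'_def sw_def)
qed

lemma missing_color:
  fixes c :: "'e \<Rightarrow> nat"
  assumes "card A < d" "finite A"
  obtains a where "a < d" "\<And>e. e \<in> A \<Longrightarrow> c e \<noteq> a"
proof -
  have "card (c ` A) < card {..<d}"
    using card_image_le[OF assms(2), of c] assms(1) by simp
  then have "\<not> {..<d} \<subseteq> c ` A"
    using card_mono[of "c ` A" "{..<d}"] assms(2) by auto
  then show thesis using that by blast
qed

text \<open>Induction on the edges. Before the edge \<open>(u, v)\<close> is added, both its ends have fewer than \<open>d\<close> edges, so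
each of them misses a colour; after a Kempe exchange they miss a common one, which is given to
\<open>(u, v)\<close>.\<close>

theorem koenig_edge_coloring:
  fixes P :: "('n::finite \<times> 'm::finite) set"
  assumes "\<And>i. left_degree P i \<le> d" "\<And>j. right_degree P j \<le> d"
  shows "\<exists>c. proper_edge_coloring P d c"
  using finite[of P] assms
proof (induction P rule: finite_induct)
  case empty
  then show ?case by (simp add: proper_edge_coloring_def)
next
  case (insert e P)
  obtain u v where uv: "e = (u, v)" by fastforce
  have left_mono: "left_degree P i \<le> left_degree (insert e P) i" for i
    unfolding left_degree_def by (intro card_mono) auto
  have right_mono: "right_degree P j \<le> right_degree (insert e P) j" for j
    unfolding right_degree_def by (intro card_mono) auto
  obtain c where c: "proper_edge_coloring P d c"
    using insert.IH[OF order_trans[OF left_mono insert.prems(1)] order_trans[OF right_mono insert.prems(2)]]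
    by blast
  have "{e' \<in> insert e P. fst e' = u} = insert e {e' \<in> P. fst e' = u}"
    using uv by auto
  then have "left_degree (insert e P) u = Suc (card {e' \<in> P. fst e' = u})"
    using insert.hyps(2) by (simp add: left_degree_def)
  then have "card {e' \<in> P. fst e' = u} < d"
    using insert.prems(1)[of u] by simp
  then obtain a where a: "a < d" "\<And>e'. e' \<in> {e' \<in> P. fst e' = u} \<Longrightarrow> c e' \<noteq> a"
    by (rule missing_color[where c = c]) auto
  have "{e' \<in> insert e P. snd e' = v} = insert e {e' \<in> P. snd e' = v}"
    using uv by auto
  then have "right_degree (insert e P) v = Suc (card {e' \<in> P. snd e' = v})"
    using insert.hyps(2) by (simp add: right_degree_def)
  then have "card {e' \<in> P. snd e' = v} < d"
    using insert.prems(2)[of v] by simp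
  then obtain b where b: "b < d" "\<And>e'. e' \<in> {e' \<in> P. snd e' = v} \<Longrightarrow> c e' \<noteq> b"
    by (rule missing_color[where c = c]) auto
  obtain c' where c': "proper_edge_coloring P d c'"
    "\<And>y. (u, y) \<in> P \<Longrightarrow> c' (u, y) \<noteq> a" "\<And>x. (x, v) \<in> P \<Longrightarrow> c' (x, v) \<noteq> a"
    using kempe_swap[OF c a(1) b(1), of u v] a(2) b(2) by auto
  have "proper_edge_coloring (insert e P) d (c'(e := a))"
    unfolding proper_edge_coloring_def
  proof (intro conjI ballI impI)
    fix e1 assume "e1 \<in> insert e P"
    then show "(c'(e := a)) e1 < d"
      using c'(1) a(1) by (auto simp: proper_edge_coloring_def)
  next
    have fresh: "c' e' \<noteq> a" if "e' \<in> P" "fst e' = fst e \<or> snd e' = snd e" for e'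
      using that c'(2)[of "snd e'"] c'(3)[of "fst e'"] uv by (metis fst_conv snd_conv prod.collapse)
    fix e1 e2 assume mem: "e1 \<in> insert e P" "e2 \<in> insert e P"
      and same: "(c'(e := a)) e1 = (c'(e := a)) e2 \<and> (fst e1 = fst e2 \<or> snd e1 = snd e2)"
    consider "e1 = e" "e2 = e" | "e1 = e" "e2 \<noteq> e" "e2 \<in> P" | "e1 \<noteq> e" "e2 = e" "e1 \<in> P"
      | "e1 \<noteq> e" "e2 \<noteq> e" "e1 \<in> P" "e2 \<in> P"
      using mem by blast
    then show "e1 = e2"
    proof cases
      case 2
      then have "c' e2 = a" "fst e2 = fst e \<or> snd e2 = snd e" using same by auto
      then show ?thesis using fresh[OF 2(3)] by blast
    next
      case 3
      then have "c' e1 = a" "fst e1 = fst e \<or> snd e1 = snd e" using same by auto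
      then show ?thesis using fresh[OF 3(3)] by blast
    next
      case 4
      then show ?thesis
        using same c'(1) unfolding proper_edge_coloring_def by simp
    qed simp
  qed
  then show ?case by blast
qed

section \<open>Packings and b-matchings\<close>

text \<open>A union of \<open>N\<close> edge-disjoint left-perfect matchings has these degrees. Conversely such a subgraph has a
proper edge colouring with \<open>N\<close> colours by the previous theorem; a left node of degree \<open>N\<close> then sees every
colour, so every colour class is a left-perfect matching.\<close>

lemma matching_packing_iff_subgraph:
  fixes E :: "('n::finite \<times> 'm::finite) set"
  shows "matching_packing E N \<longleftrightarrow>
    (\<exists>P\<subseteq>E. (\<forall>i. left_degree P i = N) \<and> (\<forall>j. right_degree P j \<le> N))"
proof
  assume "matching_packing E N"
  then obtain F :: "nat \<Rightarrow> 'n \<Rightarrow> 'm" where F: "\<And>t. t < N \<Longrightarrow> left_perfect_matching E (F t)"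
    and disj: "\<And>i. inj_on (\<lambda>t. F t i) {..<N}"
    unfolding matching_packing_def by blast
  define P where "P = {(i, F t i) | i t. t < N}"
  have "left_degree P i = N" for i
  proof -
    have "{e \<in> P. fst e = i} = (\<lambda>t. (i, F t i)) ` {..<N}"
      by (auto simp: P_def)
    moreover have "inj_on (\<lambda>t. (i, F t i)) {..<N}"
      using disj[of i] by (simp add: inj_on_def)
    ultimately show ?thesis
      by (simp add: left_degree_def card_image)
  qed
  moreover have "right_degree P j \<le> N" for j
  proof -
    have "{e \<in> P. snd e = j} \<subseteq> (\<lambda>t. (inv (F t) j, j)) ` {..<N}"
      using F by (force simp: P_def left_perfect_matching_def)
    then have "card {e \<in> P. snd e = j} \<le> card {..<N}"
      using surj_card_le[of "{..<N}"] by blast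
    then show ?thesis by (simp add: right_degree_def)
  qed
  moreover have "P \<subseteq> E"
    using F by (auto simp: P_def left_perfect_matching_def)
  ultimately show "\<exists>P\<subseteq>E. (\<forall>i. left_degree P i = N) \<and> (\<forall>j. right_degree P j \<le> N)"
    by blast
next
  assume "\<exists>P\<subseteq>E. (\<forall>i. left_degree P i = N) \<and> (\<forall>j. right_degree P j \<le> N)"
  then obtain P where P: "P \<subseteq> E" and left: "\<And>i. left_degree P i = N" and right: "\<And>j. right_degree P j \<le> N"
    by blast
  obtain c where c: "proper_edge_coloring P N c"
    using koenig_edge_coloring[OF eq_refl[OF left] right] by blast
  have "\<exists>j. (i, j) \<in> P \<and> c (i, j) = t" if "t < N" for t i
  proof -
    let ?A = "{e \<in> P. fst e = i}"
    have "inj_on c ?A"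
    proof (rule inj_onI)
      fix e e' assume "e \<in> ?A" "e' \<in> ?A" "c e = c e'"
      then have "e \<in> P" "e' \<in> P" "fst e = fst e'" "c e = c e'" by auto
      then show "e = e'"
        using c unfolding proper_edge_coloring_def by blast
    qed
    then have "card (c ` ?A) = card {..<N}"
      using left[of i] by (simp add: card_image left_degree_def)
    moreover have "c ` ?A \<subseteq> {..<N}"
      using c unfolding proper_edge_coloring_def by auto
    ultimately have "c ` ?A = {..<N}"
      by (intro card_subset_eq) auto
    moreover have "t \<in> {..<N}" using that by simp
    ultimately have "t \<in> c ` ?A" by blast
    then show ?thesis by force
  qed
  then obtain F where F: "\<And>t i. t < N \<Longrightarrow> (i, F t i) \<in> P \<and> c (i, F t i) = t"
    by metis
  have "inj (F t)" if "t < N" for t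
  proof (rule injI)
    fix x y assume "F t x = F t y"
    then show "x = y"
      using F[OF that, of x] F[OF that, of y] c unfolding proper_edge_coloring_def by fastforce
  qed
  moreover have "inj_on (\<lambda>t. F t i) {..<N}" for i
  proof (rule inj_onI)
    fix s t assume st: "s \<in> {..<N}" "t \<in> {..<N}" "F s i = F t i"
    have "s = c (i, F s i)"
      using F[of s i] st(1) by auto
    also have "\<dots> = t"
      using F[of t i] st(2) by (simp add: st(3))
    finally show "s = t" .
  qed
  moreover have "(i, F t i) \<in> E" if "t < N" for t i
    using F[OF that] P by blast
  ultimately show "matching_packing E N"
    unfolding matching_packing_def left_perfect_matching_def by (intro exI[of _ F]) simp
qed

text \<open>With the right nodes arranged in a cycle and the left nodes placed on some of its positions, the
shifts by \<open>0, ..., N - 1\<close> are edge-disjoint matchings.\<close>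

lemma matching_packing_UNIV:
  assumes nm: "CARD('n::finite) \<le> CARD('m::finite)" and N: "N \<le> CARD('m)"
  shows "matching_packing (UNIV :: ('n \<times> 'm) set) N"
proof -
  let ?m = "CARD('m)"
  obtain h :: "'n \<Rightarrow> nat" where h: "bij_betw h UNIV {0..<CARD('n)}"
    using ex_bij_betw_finite_nat[of "UNIV :: 'n set"] by auto
  obtain g :: "nat \<Rightarrow> 'm" where g: "bij_betw g {0..<?m} UNIV"
    using ex_bij_betw_nat_finite[of "UNIV :: 'm set"] by auto
  define F where "F t i = g ((h i + t) mod ?m)" for t i
  have h_less: "h i < ?m" for i
    using h nm unfolding bij_betw_def by (metis UNIV_I atLeastLessThan_iff imageI order_less_le_trans)
  have g_inj: "g x = g y \<longleftrightarrow> x = y" if "x < ?m" "y < ?m" for x y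
    using g that unfolding bij_betw_def inj_on_def by auto
  have shift: "(x + t) mod ?m = (if x + t < ?m then x + t else x + t - ?m)" if "x < ?m" "t < ?m" for x t
    using that by (simp add: le_mod_geq)
  have "inj (F t)" if "t < N" for t
  proof (rule injI)
    fix x y assume "F t x = F t y"
    then have "(h x + t) mod ?m = (h y + t) mod ?m"
      unfolding F_def by (subst (asm) g_inj) auto
    then have "h x = h y"
      using shift[OF h_less[of x], of t] shift[OF h_less[of y], of t] h_less[of x] h_less[of y] that N
      by (auto split: if_splits)
    then show "x = y"
      using h unfolding bij_betw_def inj_on_def by blast
  qed
  moreover have "inj_on (\<lambda>t. F t i) {..<N}" for i
  proof (rule inj_onI)
    fix s t assume st: "s \<in> {..<N}" "t \<in> {..<N}" "F s i = F t i"
    then have "(h i + s) mod ?m = (h i + t) mod ?m"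
      unfolding F_def by (subst (asm) g_inj) auto
    then show "s = t"
      using shift[OF h_less[of i], of s] shift[OF h_less[of i], of t] h_less[of i] st(1,2) N
      by (auto split: if_splits)
  qed
  ultimately show ?thesis
    unfolding matching_packing_def left_perfect_matching_def by blast
qed

lemma card_eq_sum_left_degree:
  fixes P :: "('n::finite \<times> 'm::finite) set"
  shows "card P = (\<Sum>i\<in>UNIV. left_degree P i)"
proof -
  have "card (\<Union>i\<in>UNIV. {e \<in> P. fst e = i}) = (\<Sum>i\<in>UNIV. card {e \<in> P. fst e = i})"
    by (rule card_UN_disjoint) auto
  moreover have "(\<Union>i\<in>UNIV. {e \<in> P. fst e = i}) = P"
    by auto
  ultimately show ?thesis
    unfolding left_degree_def by simp
qed

text \<open>The left degrees bound the size of a b-matching by \<open>(k + 1) * CARD('n)\<close>, and the cyclic construction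
attains this bound. Hence the maximum b-matchings are those in which every left node is saturated.\<close>

lemma maximum_b_matching_iff:
  fixes P :: "('n::finite \<times> 'm::finite) set"
  assumes nm: "CARD('n) \<le> CARD('m)" and k: "k + 1 \<le> CARD('m)"
  shows "maximum_b_matching k P \<longleftrightarrow>
    (\<forall>i. left_degree P i = k + 1) \<and> (\<forall>j. right_degree P j \<le> k + 1)"
proof
  assume P: "maximum_b_matching k P"
  then have b: "left_degree P i \<le> k + 1" "right_degree P j \<le> k + 1" for i j
    by (auto simp: maximum_b_matching_def b_matching_def)
  obtain Q :: "('n \<times> 'm) set" where Q: "\<And>i. left_degree Q i = k + 1" "\<And>j. right_degree Q j \<le> k + 1"
    using matching_packing_UNIV[OF nm k] unfolding matching_packing_iff_subgraph by blast
  then have "card Q \<le> card P"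
    using P by (simp add: maximum_b_matching_def b_matching_def)
  then have "(\<Sum>i\<in>(UNIV::'n set). k + 1) \<le> (\<Sum>i\<in>UNIV. left_degree P i)"
    using Q(1) by (simp add: card_eq_sum_left_degree)
  then have "left_degree P i = k + 1" for i
    using sum_mono_inv[of "left_degree P" UNIV "\<lambda>_. k + 1" i] b(1)
      sum_mono[of UNIV "left_degree P" "\<lambda>_. k + 1"] by (simp add: order_antisym)
  then show "(\<forall>i. left_degree P i = k + 1) \<and> (\<forall>j. right_degree P j \<le> k + 1)"
    using b by blast
next
  assume P: "(\<forall>i. left_degree P i = k + 1) \<and> (\<forall>j. right_degree P j \<le> k + 1)"
  have "card Q \<le> card P" if "b_matching k Q" for Q :: "('n \<times> 'm) set"
  proof -
    have "left_degree Q i \<le> left_degree P i" for i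
      using P that by (simp add: b_matching_def)
    then show ?thesis
      unfolding card_eq_sum_left_degree by (intro sum_mono)
  qed
  then show "maximum_b_matching k P"
    using P by (simp add: maximum_b_matching_def b_matching_def)
qed

lemma graph_s_rsl_ge_iff_b_matching:
  fixes E :: "('n::finite \<times> 'm::finite) set"
  assumes "CARD('n) \<le> CARD('m)"
  shows "int k \<le> graph_s_rsl E \<longleftrightarrow> k + 1 \<le> CARD('m) \<and> (\<exists>P\<subseteq>E. maximum_b_matching k P)"
proof -
  have "matching_packing E (k + 1) \<longleftrightarrow> (\<exists>P\<subseteq>E. maximum_b_matching k P)" if "k + 1 \<le> CARD('m)"
    unfolding matching_packing_iff_subgraph maximum_b_matching_iff[OF assms that] ..
  then show ?thesis
    using matching_packing_bound[of E "k + 1"] unfolding graph_s_rsl_ge_iff by blast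
qed

text \<open>Among maximum b-matchings, all of the same size, maximizing the number of edges inside \<open>E\<close> minimizes
the number of edges outside.\<close>

lemma delta_star_le_iff:
  fixes E :: "('n::finite \<times> 'm::finite) set"
  shows "delta_star E k \<le> q \<longleftrightarrow> (\<exists>P. maximum_b_matching k P \<and> card (P - E) \<le> q)"
proof -
  obtain P where P: "fair_b_matching E k P"
    using fair_b_matching_exists by blast
  have diff: "card Q - card (Q \<inter> E) = card (Q - E)" for Q :: "('n \<times> 'm) set"
    by (simp add: card_Diff_subset_Int)
  have "card (P - E) \<le> card (Q - E)" if "maximum_b_matching k Q" for Q
  proof -
    have "card Q = card P" "card (Q \<inter> E) \<le> card (P \<inter> E)"
      using P that by (auto simp: fair_b_matching_def maximum_b_matching_def intro: order_antisym)
    then show ?thesis using diff[of P] diff[of Q] by linarith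
  qed
  then show ?thesis
    using P unfolding delta_star_eq[OF P] diff fair_b_matching_def by (meson order_trans)
qed

section \<open>The optimal augmentation\<close>

text \<open>If an augmentation contains a maximum b-matching, then the edges of the latter outside \<open>E\<close> are among
the \<open>p\<close> new ones. Conversely a maximum b-matching with at most \<open>p\<close> edges outside \<open>E\<close> can be added to \<open>E\<close>,
and the budget is then filled up with arbitrary further edges; there are enough of them because
some augmentation by \<open>p\<close> edges exists at all.\<close>

lemma augmentation_reaches_iff:
  fixes E :: "('n::finite \<times> 'm::finite) set"
  assumes nm: "CARD('n) \<le> CARD('m)" and room: "\<exists>Estar. E \<subseteq> Estar \<and> card Estar - card E = p"
  shows "(\<exists>Estar. E \<subseteq> Estar \<and> card Estar - card E = p \<and> int k \<le> graph_s_rsl Estar) \<longleftrightarrow>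
    k \<le> CARD('m) - 1 \<and> delta_star E k \<le> p"
proof
  assume "\<exists>Estar. E \<subseteq> Estar \<and> card Estar - card E = p \<and> int k \<le> graph_s_rsl Estar"
  then obtain Estar P where E: "E \<subseteq> Estar" "card Estar - card E = p"
    and k: "k + 1 \<le> CARD('m)" and P: "P \<subseteq> Estar" "maximum_b_matching k P"
    unfolding graph_s_rsl_ge_iff_b_matching[OF nm] by blast
  have "card (P - E) \<le> card (Estar - E)"
    using P(1) by (intro card_mono) auto
  also have "\<dots> = p"
    using E by (simp add: card_Diff_subset)
  finally show "k \<le> CARD('m) - 1 \<and> delta_star E k \<le> p"
    using k P(2) unfolding delta_star_le_iff by auto
next
  assume "k \<le> CARD('m) - 1 \<and> delta_star E k \<le> p"
  then obtain P where k: "k \<le> CARD('m) - 1" and P: "maximum_b_matching k P" "card (P - E) \<le> p"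
    unfolding delta_star_le_iff by blast
  have k': "k + 1 \<le> CARD('m)"
    using k zero_less_card_finite[where 'a = 'm] by linarith
  obtain E0 where E0: "E \<subseteq> E0" "card E0 - card E = p"
    using room by blast
  have "card E + p \<le> card (UNIV :: ('n \<times> 'm) set)"
    using E0 card_mono[of E0 E] card_mono[of UNIV E0] by simp
  moreover have "card (E \<union> P) \<le> card E + p"
    using P(2) card_Un_le[of E "P - E"] by simp
  ultimately obtain Estar where "E \<union> P \<subseteq> Estar" "card Estar = card E + p"
    using exists_subset_between[of "E \<union> P" "card E + p" UNIV] by auto
  then have "E \<subseteq> Estar \<and> card Estar - card E = p \<and> int k \<le> graph_s_rsl Estar"
    unfolding graph_s_rsl_ge_iff_b_matching[OF nm] using k' P(1) by auto
  then show "\<exists>Estar. E \<subseteq> Estar \<and> card Estar - card E = p \<and> int k \<le> graph_s_rsl Estar" ..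
qed

theorem theorem9:
  fixes E :: "('n::finite \<times> 'm::finite) set" and p :: nat
  assumes "CARD('n) \<le> CARD('m)"
    and "p > 0"
    and "\<exists>Estar. E \<subseteq> Estar \<and> card Estar - card E = p"
  shows "Max {graph_s_rsl Estar | Estar. E \<subseteq> Estar \<and> card Estar - card E = p} =
    (let K = {k. k \<le> CARD('m) - 1 \<and> delta_star E k \<le> p}
     in if K = {} then -1 else int (Max K))"
proof -
  let ?S = "{graph_s_rsl Estar | Estar. E \<subseteq> Estar \<and> card Estar - card E = p}"
  define K where "K = {k. k \<le> CARD('m) - 1 \<and> delta_star E k \<le> p}"
  have fin: "finite ?S" by simp
  have ne: "?S \<noteq> {}" using assms(3) by blast
  have finK: "finite K" unfolding K_def by simp
  have reach: "k \<in> K \<longleftrightarrow> (\<exists>s\<in>?S. int k \<le> s)" for k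
    using augmentation_reaches_iff[OF assms(1,3), of k] unfolding K_def by auto
  have low: "-1 \<le> s" if "s \<in> ?S" for s
    using that graph_s_rsl_ge_minus_one by auto
  have in_K: "nat s \<in> K" if "s \<in> ?S" "0 \<le> s" for s
    using that unfolding reach by (intro bexI[of _ s]) auto
  have "Max ?S = (if K = {} then -1 else int (Max K))"
  proof (cases "K = {}")
    case True
    then have "s = -1" if "s \<in> ?S" for s
      using low[OF that] in_K[OF that] by force
    then show ?thesis
      using True Max_in[OF fin ne] by simp
  next
    case False
    then obtain s where s: "s \<in> ?S" "int (Max K) \<le> s"
      using Max_in[OF finK] reach by blast
    have upper: "s \<le> int (Max K)" if "s \<in> ?S" for s
      using in_K[OF that] Max_ge[OF finK, of "nat s"] by linarith
    have "Max ?S = int (Max K)"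
      using s upper[OF s(1)] upper fin by (intro Max_eqI) auto
    then show ?thesis using False by simp
  qed
  then show ?thesis by (simp add: K_def Let_def)
qed

end
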